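(* Let $\mathcal P(z)=a_0z^m+a_1z^{m-1}+\cdots+a_{m-1}z+a_m$ be a polynomial of degree $m$ with complex coefficients, and set $a_j:=0$ whenever $j<0$ or $j>m$. Let $N\in\mathbb N$ satisfy $\varphi(N)\le m$. Then $\mathcal P(z)$ is divisible by the cyclotomic polynomial $\Phi_N(z)$ if and only if $$\sum_{d\mid N}\mu(d)\sum_{\substack{j\in\mathbb Z\\ j\equiv h-\sum_{p\mid d}\frac{N}{p}\ (\mathrm{mod}\ N)}} a_j=0$$ for every $h\in\{0,1,\ldots,N-1\}$. Moreover, when $N$ is even, it suffices that this identity holds for every $h\in\{0,1,\ldots,N/2-1\}$.
   Context: $\Phi_N(z)=\prod_{1\le j\le N,\ (j,N)=1}(z-e^{2\pi i j/N})$ is the $N$th cyclotomic polynomial, $\varphi$ is Euler's totient function and $\mu$ is the Möbius function. In the inner condition, $p$ ranges over the prime divisors of $d$, and the sum $\sum_{p\mid d}N/p$ is taken to be $0$ when $d=1$. *)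

theory Defs
  imports
    "HOL-Analysis.Infinite_Sum"
    "HOL-Computational_Algebra.Computational_Algebra"
    "HOL-Number_Theory.Totient"
begin

definition cyclotomic_poly :: "nat \<Rightarrow> complex poly" where
  "cyclotomic_poly N =
     (\<Prod>j | 1 \<le> j \<and> j \<le> N \<and> coprime j N. [:- exp (2 * of_real pi * \<i> * of_nat j / of_nat N), 1:])"

definition moebius_mu :: "nat \<Rightarrow> int" where
  "moebius_mu n = (if squarefree n then (-1) ^ card (prime_factors n) else 0)"

(* a is a finitely supported sequence on the integers, so infsum is a finite sum here.
   The quotient N div p is exact, since p divides d and d divides N. *)
definition divisibility_sum :: "(int \<Rightarrow> complex) \<Rightarrow> nat \<Rightarrow> int \<Rightarrow> complex" where
  "divisibility_sum a N h =
     (\<Sum>d | d dvd N. of_int (moebius_mu d) *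
        (\<Sum>\<^sub>\<infinity>j | [j = h - (\<Sum>p\<in>prime_factors d. int (N div p))] (mod int N). a j))"

end

theory Submission
  imports Defs "HOL-Analysis.Complex_Transcendental"
begin

text \<open>
  Let \<open>S h\<close> be the divisibility sum and \<open>c p = N div p\<close>.  Only squarefree \<open>d\<close> contribute to
  \<open>S h\<close>, and these correspond to sets of prime divisors of \<open>N\<close>; hence for every \<open>N\<close>-th root of
  unity \<open>w\<close>, the discrete Fourier transform of \<open>S\<close> factors as
  \<open>(\<Sum>h<N. S h * w ^ h) = (\<Prod>p\<in>prime_factors N. 1 - w ^ c p) * (\<Sum>j\<le>m. a j * w ^ j)\<close>.
  The product vanishes unless \<open>w\<close> is a primitive root, and the last sum equals
  \<open>w ^ m * P (1 / w)\<close>.  So the transform of \<open>S\<close>, and with it \<open>S\<close> itself, is zero iff \<open>P\<close>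
  vanishes at all primitive \<open>N\<close>-th roots of unity.  For even \<open>N\<close>, pairing \<open>d\<close> with \<open>2 * d\<close> for
  odd \<open>d\<close> shows \<open>S (h + N / 2) = - S h\<close>.
\<close>

section \<open>Cyclotomic polynomials and primitive roots of unity\<close>

lemma prod_linear_factors_dvd_iff:
  fixes p :: "'a :: idom poly"
  assumes "finite A"
  shows "(\<Prod>x\<in>A. [:- x, 1:]) dvd p \<longleftrightarrow> (\<forall>x\<in>A. poly p x = 0)"
proof
  assume *: "(\<Prod>x\<in>A. [:- x, 1:]) dvd p"
  show "\<forall>x\<in>A. poly p x = 0"
  proof
    fix x assume "x \<in> A"
    then have "[:- x, 1:] dvd p"
      using dvd_trans[OF dvd_prodI[OF assms] *] by blast
    then show "poly p x = 0" by (simp add: poly_eq_0_iff_dvd)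
  qed
next
  assume "\<forall>x\<in>A. poly p x = 0"
  with assms show "(\<Prod>x\<in>A. [:- x, 1:]) dvd p"
  proof (induction A arbitrary: p rule: finite_induct)
    case (insert x A)
    then obtain q where q: "p = [:- x, 1:] * q"
      by (metis insertI1 poly_eq_0_iff_dvd dvdE)
    \<comment> \<open>As \<open>y\<close> differs from \<open>x\<close>, the factor
      \<open>[:- x, 1:]\<close> is nonzero at \<open>y\<close>, so in an integral domain the root
      must come from \<open>q\<close>.\<close>
    have "poly q y = 0" if "y \<in> A" for y
      using insert.prems insert.hyps that unfolding q by fastforce
    then have "(\<Prod>x\<in>A. [:- x, 1:]) dvd q"
      using insert.IH by blast
    then show ?case
      using insert.hyps unfolding q by (simp add: mult_dvd_mono del: mult_pCons_left)
  qed simp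
qed

text \<open>These are the elements of multiplicative order exactly \<open>N\<close>. Testing only
  the exponents \<open>N div p\<close> makes primitivity the same as nonvanishing of all factors
  \<open>1 - w ^ (N div p)\<close> of the Fourier transform.\<close>

definition primitive_roots_unity :: "nat \<Rightarrow> complex set" where
  "primitive_roots_unity N = {w. w ^ N = 1 \<and> (\<forall>p\<in>prime_factors N. w ^ (N div p) \<noteq> 1)}"

text \<open>Needed because the transform at \<open>w\<close> involves the value of the polynomial at
  \<open>1 / w\<close>.\<close>

lemma inverse_primitive_roots_unity:
  "inverse w \<in> primitive_roots_unity N \<longleftrightarrow> w \<in> primitive_roots_unity N"
  by (simp add: primitive_roots_unity_def power_inverse inverse_eq_1_iff)

lemma coprime_iff_prime_factors:
  fixes j N :: nat
  assumes "N > 0"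
  shows "coprime j N \<longleftrightarrow> (\<forall>p\<in>prime_factors N. \<not> p dvd j)"
proof
  assume "coprime j N"
  then show "\<forall>p\<in>prime_factors N. \<not> p dvd j"
    by (metis coprime_common_divisor in_prime_factors_iff not_prime_unit)
next
  assume *: "\<forall>p\<in>prime_factors N. \<not> p dvd j"
  show "coprime j N"
  proof (rule ccontr)
    assume "\<not> coprime j N"
    then have "gcd j N \<noteq> 1" by (simp add: coprime_iff_gcd_eq_1)
    then obtain p where "prime p" "p dvd gcd j N"
      using prime_factor_nat by blast
    then show False using * assms by (auto simp: in_prime_factors_iff)
  qed
qed

text \<open>Raising the \<open>j\<close>-th root to the power \<open>N / p\<close> gives
  \<open>exp (2 * pi * i * j / p)\<close>, which is 1 iff \<open>p\<close> divides \<open>j\<close>.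
  Primitivity thus says that no prime factor of \<open>N\<close> divides \<open>j\<close>.\<close>

lemma bij_betw_primitive_roots_unity:
  assumes "N > 0"
  shows "bij_betw (\<lambda>j. exp (2 * of_real pi * \<i> * of_nat j / of_nat N))
           {j. 1 \<le> j \<and> j \<le> N \<and> coprime j N} (primitive_roots_unity N)"
    (is "bij_betw ?e ?J _")
proof -
  have pow: "?e j ^ k = ?e (k * j)" for j k
    by (simp add: exp_of_nat_mult[symmetric] mult_ac)
  have pow_N: "?e j ^ N = 1" for j
    unfolding pow using complex_root_unity_eq_1[of N "N * j"] assms by simp
  have pow_p: "?e j ^ (N div p) = 1 \<longleftrightarrow> p dvd j" if "p \<in> prime_factors N" for j p
  proof -
    obtain k where k: "N = p * k" using \<open>p \<in> prime_factors N\<close> by (auto simp: in_prime_factors_iff)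
    with assms have "p > 0" "k > 0" by auto
    then show ?thesis
      unfolding pow using complex_root_unity_eq_1[of N "N div p * j"] assms
      by (simp add: k mult.commute[of p])
  qed
  have prim: "?e j \<in> primitive_roots_unity N \<longleftrightarrow> coprime j N" for j
    using pow_p pow_N assms by (auto simp: primitive_roots_unity_def coprime_iff_prime_factors)
  have "inj_on ?e ?J"
  proof (rule inj_onI)
    fix j k assume j: "j \<in> ?J" and k: "k \<in> ?J" and "?e j = ?e k"
    then have "j mod N = k mod N"
      using complex_root_unity_eq[of N j k] assms by simp
    then show "j = k"
      using j k by (cases "j = N"; cases "k = N") auto
  qed
  moreover have "?e ` ?J = primitive_roots_unity N"
  proof
    show "?e ` ?J \<subseteq> primitive_roots_unity N" using prim by auto
    show "primitive_roots_unity N \<subseteq> ?e ` ?J"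
    proof
      fix w assume w: "w \<in> primitive_roots_unity N"
      then have "w \<in> {z. z ^ N = 1}" by (simp add: primitive_roots_unity_def)
      then obtain k where k: "k < N" "w = cis (2 * pi * real k / real N)"
        using bij_betw_imp_surj_on[OF Complex.bij_betw_roots_unity[OF assms]] by auto
      \<comment> \<open>The roots are enumerated with exponents from 0 to \<open>N - 1\<close>, but
        the cyclotomic product runs from 1 to \<open>N\<close>. The exponents 0 and \<open>N\<close>
        give the same root; this matters for \<open>N = 1\<close>.\<close>
      define j where "j = (if k = 0 then N else k)"
      have "w = ?e k" unfolding k(2) cis_conv_exp by (simp add: mult_ac)
      also have "\<dots> = ?e j"
        using complex_root_unity_eq[of N k j] assms by (simp add: j_def)
      finally have "w = ?e j" .
      then have "coprime j N" using w prim by simp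
      with \<open>w = ?e j\<close> k(1) assms show "w \<in> ?e ` ?J"
        by (intro image_eqI[of _ _ j]) (auto simp: j_def)
    qed
  qed
  ultimately show ?thesis by (simp add: bij_betw_def)
qed

lemma cyclotomic_poly_dvd_iff:
  assumes "N > 0"
  shows "cyclotomic_poly N dvd P \<longleftrightarrow> (\<forall>w\<in>primitive_roots_unity N. poly P w = 0)"
proof -
  note bij = bij_betw_primitive_roots_unity[OF assms]
  have "finite {j. 1 \<le> j \<and> j \<le> N \<and> coprime j N}"
    by (rule finite_subset[of _ "{..N}"]) auto
  then have "finite (primitive_roots_unity N)" using bij_betw_finite[OF bij] by simp
  moreover have "cyclotomic_poly N = (\<Prod>w\<in>primitive_roots_unity N. [:- w, 1:])"
    unfolding cyclotomic_poly_def by (rule prod.reindex_bij_betw[OF bij])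
  ultimately show ?thesis by (simp add: prod_linear_factors_dvd_iff)
qed

section \<open>Moebius sums over divisors as signed sums over sets of primes\<close>

lemma prime_factors_prod_primes:
  fixes X :: "nat set"
  assumes "finite X" and "\<And>p. p \<in> X \<Longrightarrow> prime p"
  shows "prime_factors (\<Prod>X) = X"
proof -
  have "prime_factorization (prod_mset (mset_set X)) = mset_set X"
    by (rule prime_factorization_prod_mset_primes) (use assms in auto)
  then show ?thesis using assms(1) by (simp add: prod_unfold_prod_mset)
qed

lemma squarefree_prod_primes:
  fixes X :: "nat set"
  assumes "\<And>p. p \<in> X \<Longrightarrow> prime p"
  shows "squarefree (\<Prod>X)"
  by (rule squarefree_prod_coprime) (auto simp: assms primes_coprime squarefree_prime)

lemma prod_prime_factors_squarefree:
  fixes d :: nat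
  assumes "squarefree d"
  shows "\<Prod>(prime_factors d) = d"
proof -
  have "d \<noteq> 0" using assms by (metis not_squarefree_0)
  then have "(\<Prod>p\<in>prime_factors d. p ^ multiplicity p d) = d"
    by (simp add: prod_prime_factors)
  moreover have "multiplicity p d = 1" if "p \<in> prime_factors d" for p
    using that assms \<open>d \<noteq> 0\<close> by (simp add: squarefree_factorial_semiring'')
      (metis in_prime_factors_iff multiplicity_gt_zero_iff le_antisym Suc_leI One_nat_def
         not_prime_unit prime_factors_multiplicity mem_Collect_eq)
  ultimately show ?thesis by simp
qed

lemma prod_primes_dvd:
  fixes N :: nat
  assumes "N > 0" "X \<subseteq> prime_factors N"
  shows "\<Prod>X dvd N"
proof -
  have "\<Prod>X dvd \<Prod>(prime_factors N)"
    using assms(2) by (intro prod_dvd_prod_subset) auto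
  also have "\<dots> dvd (\<Prod>p\<in>prime_factors N. p ^ multiplicity p N)"
    by (intro prod_dvd_prod dvd_power) (auto simp: prime_factors_multiplicity)
  also have "\<dots> = N" using assms(1) by (simp add: prod_prime_factors)
  finally show ?thesis .
qed

text \<open>Apart from the Moebius factor, the summand sees \<open>d\<close> only through its set of
  primes. On squarefree \<open>d\<close>, \<open>prime_factors\<close> and the product of a set are
  mutually inverse.\<close>

lemma sum_divisors_moebius_mu:
  fixes G :: "nat set \<Rightarrow> 'a :: comm_ring_1"
  assumes "N > 0"
  shows "(\<Sum>d | d dvd N. of_int (moebius_mu d) * G (prime_factors d)) =
         (\<Sum>X\<in>Pow (prime_factors N). (-1) ^ card X * G X)"
proof -
  have "(\<Sum>d | d dvd N. of_int (moebius_mu d) * G (prime_factors d)) =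
        (\<Sum>d | d dvd N \<and> squarefree d. of_int (moebius_mu d) * G (prime_factors d))"
    using assms by (intro sum.mono_neutral_right) (auto simp: moebius_mu_def)
  also have "\<dots> = (\<Sum>X\<in>Pow (prime_factors N). (-1) ^ card X * G X)"
  proof (rule sum.reindex_bij_witness[of _ "\<lambda>X. \<Prod>X" prime_factors])
    fix X assume X: "X \<in> Pow (prime_factors N)"
    then have "finite X" "\<And>p. p \<in> X \<Longrightarrow> prime p"
      by (auto intro: finite_subset simp: in_prime_factors_iff)
    then show "prime_factors (\<Prod>X) = X" "\<Prod>X \<in> {d. d dvd N \<and> squarefree d}"
      using X assms by (auto simp: prime_factors_prod_primes squarefree_prod_primes prod_primes_dvd)
  next
    fix d assume d: "d \<in> {d. d dvd N \<and> squarefree d}"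
    then show "\<Prod>(prime_factors d) = d" by (simp add: prod_prime_factors_squarefree)
    show "prime_factors d \<in> Pow (prime_factors N)"
      using d assms by (simp add: dvd_prime_factors)
    show "(-1) ^ card (prime_factors d) * G (prime_factors d) =
          of_int (moebius_mu d) * G (prime_factors d)"
      using d by (simp add: moebius_mu_def)
  qed
  finally show ?thesis .
qed

section \<open>Residue class sums and their discrete Fourier transform\<close>

definition residue_sum :: "(int \<Rightarrow> complex) \<Rightarrow> nat \<Rightarrow> nat \<Rightarrow> int \<Rightarrow> complex" where
  "residue_sum a m N r = (\<Sum>j | j \<le> m \<and> [int j = r] (mod int N). a (int j))"

lemma residue_sum_cong:
  "[r = s] (mod int N) \<Longrightarrow> residue_sum a m N r = residue_sum a m N s"
  unfolding residue_sum_def by (metis cong_trans cong_sym)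

lemma infsum_residue_class:
  assumes "\<forall>j. j < 0 \<or> j > int m \<longrightarrow> a j = 0"
  shows "(\<Sum>\<^sub>\<infinity>j | [j = r] (mod int N). a j) = residue_sum a m N r"
proof -
  let ?J = "{j. j \<le> m \<and> [int j = r] (mod int N)}"
  have "(\<Sum>\<^sub>\<infinity>j | [j = r] (mod int N). a j) = infsum a (int ` ?J)"
  proof (rule infsum_cong_neutral)
    fix j assume "j \<in> {j. [j = r] (mod int N)} - int ` ?J"
    then have "j < 0 \<or> j > int m"
      by (metis (mono_tags, lifting) DiffE image_eqI mem_Collect_eq nat_le_iff int_nat_eq
           linorder_not_less)
    then show "a j = 0" using assms by blast
  qed auto
  also have "\<dots> = sum a (int ` ?J)" by simp
  also have "\<dots> = residue_sum a m N r"
    unfolding residue_sum_def by (subst sum.reindex) auto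
  finally show ?thesis .
qed

lemma divisibility_sum_eq:
  assumes "\<forall>j. j < 0 \<or> j > int m \<longrightarrow> a j = 0" and "N > 0"
  shows "divisibility_sum a N h =
    (\<Sum>X\<in>Pow (prime_factors N).
       (-1) ^ card X * residue_sum a m N (h - (\<Sum>p\<in>X. int (N div p))))"
  unfolding divisibility_sum_def infsum_residue_class[OF assms(1)]
  by (rule sum_divisors_moebius_mu[OF assms(2),
        where G = "\<lambda>X. residue_sum a m N (h - (\<Sum>p\<in>X. int (N div p)))"])

text \<open>Each \<open>j\<close> is counted for exactly one \<open>h < N\<close>, namely
  \<open>(j + s) mod N\<close>, and \<open>w ^ N = 1\<close> allows the exponent to be left
  unreduced. Shifting by \<open>s\<close> therefore becomes multiplication by
  \<open>w ^ s\<close>.\<close>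

lemma fourier_residue_sum:
  assumes "N > 0" "w ^ N = 1"
  shows "(\<Sum>h<N. residue_sum a m N (int h - int s) * w ^ h) =
         w ^ s * (\<Sum>j\<le>m. a (int j) * w ^ j)"
proof -
  have iff: "[int j = int h - int s] (mod int N) \<longleftrightarrow> h = (j + s) mod N" if "h < N" for h j
  proof -
    have "[int j = int h - int s] (mod int N) \<longleftrightarrow> [int (j + s) = int h] (mod int N)"
      using cong_add_rcancel[of "int j" "int s" "int h - int s" "int N"] by simp
    also have "\<dots> \<longleftrightarrow> h = (j + s) mod N"
      unfolding cong_int_iff using that by (auto simp: cong_def)
    finally show ?thesis .
  qed
  have mod: "w ^ (k mod N) = w ^ k" for k
  proof -
    have "w ^ k = w ^ (k mod N + N * (k div N))" by simp
    also have "\<dots> = w ^ (k mod N)" unfolding power_add power_mult assms(2) by simp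
    finally show ?thesis by simp
  qed
  have "(\<Sum>h<N. residue_sum a m N (int h - int s) * w ^ h) =
        (\<Sum>h<N. \<Sum>j\<le>m. if h = (j + s) mod N then a (int j) * w ^ h else 0)"
  proof (rule sum.cong[OF refl])
    fix h assume "h \<in> {..<N}"
    then have "residue_sum a m N (int h - int s) = (\<Sum>j | j \<in> {..m} \<and> h = (j + s) mod N. a (int j))"
      by (simp add: residue_sum_def iff)
    also have "\<dots> = (\<Sum>j\<le>m. if h = (j + s) mod N then a (int j) else 0)"
      by (subst sum.inter_filter) simp_all
    finally show "residue_sum a m N (int h - int s) * w ^ h =
                  (\<Sum>j\<le>m. if h = (j + s) mod N then a (int j) * w ^ h else 0)"
      by (simp add: sum_distrib_right if_distrib[of "\<lambda>x. x * _"] cong: if_cong)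
  qed
  also have "\<dots> = (\<Sum>j\<le>m. \<Sum>h<N. if h = (j + s) mod N then a (int j) * w ^ h else 0)"
    by (rule sum.swap)
  also have "\<dots> = (\<Sum>j\<le>m. a (int j) * w ^ (j + s))"
    using assms(1) by (simp add: mod)
  also have "\<dots> = w ^ s * (\<Sum>j\<le>m. a (int j) * w ^ j)"
    by (simp add: sum_distrib_left power_add mult_ac)
  finally show ?thesis .
qed

lemma fourier_divisibility_sum:
  assumes "\<forall>j. j < 0 \<or> j > int m \<longrightarrow> a j = 0" and "N > 0" and "w ^ N = 1"
  shows "(\<Sum>h<N. divisibility_sum a N (int h) * w ^ h) =
         (\<Prod>p\<in>prime_factors N. 1 - w ^ (N div p)) * (\<Sum>j\<le>m. a (int j) * w ^ j)"
proof -
  let ?s = "\<lambda>X. \<Sum>p\<in>X. N div p"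
  have "(\<Sum>h<N. divisibility_sum a N (int h) * w ^ h) =
        (\<Sum>h<N. \<Sum>X\<in>Pow (prime_factors N).
           (-1) ^ card X * (residue_sum a m N (int h - int (?s X)) * w ^ h))"
    by (simp add: divisibility_sum_eq[OF assms(1,2)] sum_distrib_right mult.assoc)
  also have "\<dots> = (\<Sum>X\<in>Pow (prime_factors N). (-1) ^ card X *
                    (\<Sum>h<N. residue_sum a m N (int h - int (?s X)) * w ^ h))"
    by (subst sum.swap) (simp add: sum_distrib_left)
  also have "\<dots> = (\<Sum>X\<in>Pow (prime_factors N). (-1) ^ card X *
                    (w ^ ?s X * (\<Sum>j\<le>m. a (int j) * w ^ j)))"
    by (simp only: fourier_residue_sum[OF assms(2,3)])
  \<comment> \<open>The trivial product over the complement of \<open>X\<close> gives the sum the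
    shape of the expansion of a product of differences over all subsets.\<close>
  also have "\<dots> = (\<Sum>X\<in>Pow (prime_factors N). (-1) ^ card X * (\<Prod>p\<in>X. w ^ (N div p)) *
                    (\<Prod>p\<in>prime_factors N - X. 1)) * (\<Sum>j\<le>m. a (int j) * w ^ j)"
    unfolding sum_distrib_right by (simp add: power_sum mult.assoc)
  also have "(\<Sum>X\<in>Pow (prime_factors N). (-1) ^ card X * (\<Prod>p\<in>X. w ^ (N div p)) *
                    (\<Prod>p\<in>prime_factors N - X. 1)) = (\<Prod>p\<in>prime_factors N. 1 - w ^ (N div p))"
    by (rule prod_diff_conv_sum[symmetric]) simp
  finally show ?thesis .
qed

text \<open>The transform consists of the values of a polynomial of degree less than
  \<open>N\<close> with coefficients \<open>S h\<close>. If it vanishes at all \<open>N\<close>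
  roots of unity, it is the zero polynomial.\<close>

lemma eq_0_if_fourier_eq_0:
  fixes S :: "nat \<Rightarrow> complex"
  assumes "N > 0" and "\<And>w. w ^ N = 1 \<Longrightarrow> (\<Sum>h<N. S h * w ^ h) = 0" and "h < N"
  shows "S h = 0"
proof -
  let ?F = "\<Sum>h<N. monom (S h) h"
  have "degree ?F < N"
    by (rule degree_sum_less) (use assms(1) in \<open>auto intro: le_less_trans[OF degree_monom_le]\<close>)
  moreover have "poly ?F w = 0" if "w \<in> {z. z ^ N = 1}" for w
    using assms(2) that by (simp add: poly_sum poly_monom)
  ultimately have "?F = 0"
    using assms(1) by (intro poly_eqI_degree[of "{z. z ^ N = 1}"]) (auto simp: card_roots_unity_eq)
  then have "coeff ?F h = 0" by simp
  then show ?thesis using assms(3) by (simp add: coeff_sum)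
qed

section \<open>Antisymmetry under a shift by half the period for even \<open>N\<close>\<close>

lemma sum_Pow_insert:
  assumes "finite A" "x \<notin> A"
  shows "(\<Sum>X\<in>Pow (insert x A). f X) = (\<Sum>X\<in>Pow A. f X) + (\<Sum>X\<in>Pow A. f (insert x X))"
proof -
  have "inj_on (insert x) (Pow A)" using assms(2) by (auto simp: inj_on_def)
  then have "(\<Sum>X\<in>insert x ` Pow A. f X) = (\<Sum>X\<in>Pow A. f (insert x X))"
    by (subst sum.reindex) auto
  then show ?thesis
    unfolding Pow_insert using assms by (subst sum.union_disjoint) auto
qed

lemma divisibility_sum_add_half:
  assumes "\<forall>j. j < 0 \<or> j > int m \<longrightarrow> a j = 0" and "N > 0" and "even N"
  shows "divisibility_sum a N (h + int (N div 2)) = - divisibility_sum a N h"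
proof -
  define A where "A = prime_factors N - {2}"
  \<comment> \<open>\<open>T\<close> is the contribution of the odd divisors. Adding the prime 2 to
    \<open>X\<close> flips the sign and shifts the argument by a further
    \<open>N div 2\<close>.\<close>
  define T where "T h = (\<Sum>X\<in>Pow A. (-1) ^ card X *
                           residue_sum a m N (h - (\<Sum>p\<in>X. int (N div p))))" for h
  have A: "prime_factors N = insert 2 A" "finite A" "2 \<notin> A"
    using assms(2,3) by (auto simp: A_def in_prime_factors_iff)
  have S: "divisibility_sum a N h = T h - T (h - int (N div 2))" for h
  proof -
    have "(\<Sum>X\<in>Pow A. (-1) ^ card (insert 2 X) *
             residue_sum a m N (h - (\<Sum>p\<in>insert 2 X. int (N div p)))) = - T (h - int (N div 2))"
      unfolding T_def sum_negf[symmetric]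
    proof (rule sum.cong[OF refl])
      fix X assume "X \<in> Pow A"
      then have "finite X" "2 \<notin> X" using A by (auto intro: finite_subset)
      then show "(-1) ^ card (insert 2 X) *
             residue_sum a m N (h - (\<Sum>p\<in>insert 2 X. int (N div p))) =
           - ((-1) ^ card X *
             residue_sum a m N (h - int (N div 2) - (\<Sum>p\<in>X. int (N div p))))"
        by (simp add: algebra_simps)
    qed
    then show ?thesis
      unfolding divisibility_sum_eq[OF assms(1,2)] A(1) sum_Pow_insert[OF A(2,3)]
      by (simp add: T_def)
  qed
  \<comment> \<open>The two arguments differ by the period \<open>N\<close>. Hence moving
    \<open>h\<close> by \<open>N div 2\<close> interchanges the two terms in \<open>S\<close>, which
    reverses the sign.\<close>
  have "T (h + int (N div 2)) = T (h - int (N div 2))"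
    unfolding T_def
  proof (intro sum.cong refl arg_cong2[of _ _ _ _ "(*)"] residue_sum_cong)
    fix X
    have "int N = int (N div 2) + int (N div 2)" using assms(3) by (auto elim!: evenE)
    then show "[h + int (N div 2) - (\<Sum>p\<in>X. int (N div p)) =
                h - int (N div 2) - (\<Sum>p\<in>X. int (N div p))] (mod int N)"
      by (simp add: cong_iff_dvd_diff)
  qed
  then show ?thesis unfolding S by simp
qed

section \<open>Divisibility criterion and its half-range form\<close>

theorem theorem1p1:
  fixes P :: "complex poly" and a :: "int \<Rightarrow> complex" and m N :: nat
  assumes "degree P = m"
    and "P = (\<Sum>j=0..m. monom (a (int j)) (m - j))"
    and "\<And>j. j < 0 \<or> j > int m \<Longrightarrow> a j = 0"
    and "N > 0"
    and "totient N \<le> m"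
  shows "(cyclotomic_poly N dvd P \<longleftrightarrow> (\<forall>h\<in>{0..<N}. divisibility_sum a N (int h) = 0)) \<and>
         (even N \<longrightarrow>
           (cyclotomic_poly N dvd P \<longleftrightarrow> (\<forall>h\<in>{0..<N div 2}. divisibility_sum a N (int h) = 0)))"
proof -
  let ?S = "\<lambda>h. divisibility_sum a N (int h)"
  have support: "\<forall>j. j < 0 \<or> j > int m \<longrightarrow> a j = 0" using assms(3) by blast
  note fourier = fourier_divisibility_sum[OF support assms(4)]
  \<comment> \<open>The coefficients are numbered from the leading term downwards, so evaluating at
    the inverse and clearing denominators turns \<open>a j\<close> into the coefficient of
    \<open>w ^ j\<close>.\<close>
  have poly_inverse: "poly P (inverse w) * w ^ m = (\<Sum>j\<le>m. a (int j) * w ^ j)" if "w \<noteq> 0" for w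
  proof -
    have "poly P (inverse w) = (\<Sum>j\<le>m. a (int j) * inverse w ^ (m - j))"
      by (subst assms(2)) (simp add: poly_sum poly_monom atMost_atLeast0)
    then have "poly P (inverse w) * w ^ m = (\<Sum>j\<le>m. a (int j) * inverse w ^ (m - j) * w ^ m)"
      by (simp add: sum_distrib_right)
    also have "\<dots> = (\<Sum>j\<le>m. a (int j) * w ^ j)"
      using that by (intro sum.cong) (auto simp: field_simps power_diff)
    finally show ?thesis .
  qed
  have nonzero: "w \<noteq> 0" if "w ^ N = 1" for w :: complex
    using that assms(4) by (metis power_0_left less_irrefl zero_neq_one)
  have "?S h = 0" if "cyclotomic_poly N dvd P" "h < N" for h
  proof (rule eq_0_if_fourier_eq_0[where S = ?S, OF assms(4) _ that(2)])
    fix w :: complex assume w: "w ^ N = 1"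
    show "(\<Sum>h<N. ?S h * w ^ h) = 0"
    proof (cases "w \<in> primitive_roots_unity N")
      case True
      then have "poly P (inverse w) = 0"
        using that(1) assms(4) by (simp add: cyclotomic_poly_dvd_iff inverse_primitive_roots_unity)
      then show ?thesis
        unfolding fourier[OF w] poly_inverse[OF nonzero[OF w], symmetric] by simp
    next
      case False
      then show ?thesis
        unfolding fourier[OF w] using w by (auto simp: primitive_roots_unity_def)
    qed
  qed
  moreover have "cyclotomic_poly N dvd P" if S: "\<forall>h\<in>{0..<N}. ?S h = 0"
    unfolding cyclotomic_poly_dvd_iff[OF assms(4)]
  proof
    fix v assume "v \<in> primitive_roots_unity N"
    then have w: "inverse v \<in> primitive_roots_unity N" by (simp add: inverse_primitive_roots_unity)
    then have "inverse v ^ N = 1" by (simp add: primitive_roots_unity_def)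
    note nz = nonzero[OF this]
    \<comment> \<open>The transform is taken at \<open>inverse v\<close> so that \<open>P\<close> is
      evaluated at \<open>v\<close> itself. Primitivity makes every factor of the product nonzero,
      which leaves \<open>poly P v = 0\<close>.\<close>
    have "(\<Prod>p\<in>prime_factors N. 1 - inverse v ^ (N div p)) * (poly P v * inverse v ^ m) = 0"
      using S fourier[OF \<open>inverse v ^ N = 1\<close>] poly_inverse[OF nz] by simp
    then show "poly P v = 0"
      using w nz by (auto simp: primitive_roots_unity_def)
  qed
  ultimately have main: "cyclotomic_poly N dvd P \<longleftrightarrow> (\<forall>h\<in>{0..<N}. ?S h = 0)" by auto
  moreover have "(\<forall>h\<in>{0..<N}. ?S h = 0) \<longleftrightarrow> (\<forall>h\<in>{0..<N div 2}. ?S h = 0)" if "even N"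
  proof
    assume half: "\<forall>h\<in>{0..<N div 2}. ?S h = 0"
    show "\<forall>h\<in>{0..<N}. ?S h = 0"
    proof
      fix h assume h: "h \<in> {0..<N}"
      show "?S h = 0"
      proof (cases "h < N div 2")
        case False
        have "h - N div 2 < N div 2" using h \<open>even N\<close> False by (auto elim!: evenE)
        \<comment> \<open>Without \<open>of_nat_diff\<close> the index stays the image of a natural
          number below \<open>N div 2\<close>, as \<open>half\<close> requires.\<close>
        then have "?S (h - N div 2) = 0" using half by (simp del: of_nat_diff)
        then show ?thesis
          using divisibility_sum_add_half[OF support assms(4) \<open>even N\<close>, of "int (h - N div 2)"]
            False by simp
      qed (use half in auto)
    qed
  qed auto
  ultimately show ?thesis by simp
qed

end
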